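(* If $H$ is a finite abelian group, then there exists a semidirect product $A\rtimes B$ of finite abelian groups $A$ and $B$ such that $\mathrm{Out}_{col}(A\rtimes B)\cong H$.
   Context: An automorphism $\sigma$ of a finite group $G$ is a Coleman automorphism if for any prime $p$ dividing $|G|$ and any Sylow $p$-subgroup $P$ of $G$ there exists $g\in G$ such that $\sigma|_P=\mathrm{conj}(g)|_P$, where $\mathrm{conj}(g)$ is the map $x\mapsto g^{-1}xg$. $\mathrm{Aut}_{col}(G)$ is the group of Coleman automorphisms and $\mathrm{Out}_{col}(G)=\mathrm{Aut}_{col}(G)/\mathrm{Inn}(G)$. *)

theory Defs
  imports "HOL-Algebra.Sylow" "HOL-Algebra.Bij"
begin

definition sylow_subgroup :: "nat \<Rightarrow> 'a set \<Rightarrow> ('a, 'm) monoid_scheme \<Rightarrow> bool" where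
  "sylow_subgroup p P G \<longleftrightarrow> subgroup P G \<and> card P = p ^ multiplicity p (order G)"

text \<open>Members of \<^const>\<open>auto\<close> are extensional, so conjugation is restricted to the carrier.\<close>

definition conj_by :: "('a, 'm) monoid_scheme \<Rightarrow> 'a \<Rightarrow> 'a \<Rightarrow> 'a" where
  "conj_by G g = (\<lambda>x\<in>carrier G. inv\<^bsub>G\<^esub> g \<otimes>\<^bsub>G\<^esub> x \<otimes>\<^bsub>G\<^esub> g)"

definition Inn :: "('a, 'm) monoid_scheme \<Rightarrow> ('a \<Rightarrow> 'a) set" where
  "Inn G = conj_by G ` carrier G"

definition coleman_auto :: "('a, 'm) monoid_scheme \<Rightarrow> ('a \<Rightarrow> 'a) set" where
  "coleman_auto G = {\<sigma> \<in> auto G. \<forall>p P. prime p \<and> p dvd order G \<and> sylow_subgroup p P G \<longrightarrow>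
     (\<exists>g\<in>carrier G. \<forall>x\<in>P. \<sigma> x = conj_by G g x)}"

definition Aut_col :: "('a, 'm) monoid_scheme \<Rightarrow> ('a \<Rightarrow> 'a) monoid" where
  "Aut_col G = AutoGroup G\<lparr>carrier := coleman_auto G\<rparr>"

definition Out_col :: "('a, 'm) monoid_scheme \<Rightarrow> ('a \<Rightarrow> 'a) set monoid" where
  "Out_col G = Aut_col G Mod Inn G"

lemma coleman_autoI:
  assumes "\<sigma> \<in> auto G"
    and "\<And>p P. prime p \<Longrightarrow> p dvd order G \<Longrightarrow> sylow_subgroup p P G \<Longrightarrow>
           \<exists>g\<in>carrier G. \<forall>x\<in>P. \<sigma> x = conj_by G g x"
  shows "\<sigma> \<in> coleman_auto G"
  unfolding coleman_auto_def using assms(1) by (auto intro!: assms(2))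

lemma coleman_autoD:
  assumes "\<sigma> \<in> coleman_auto G" "prime p" "p dvd order G" "sylow_subgroup p P G"
  shows "\<exists>g\<in>carrier G. \<forall>x\<in>P. \<sigma> x = conj_by G g x"
  using assms by (simp add: coleman_auto_def)

lemma mult_AutoGroup:
  assumes "f \<in> auto G" "g \<in> auto G"
  shows "f \<otimes>\<^bsub>AutoGroup G\<^esub> g = compose (carrier G) f g"
  using assms by (simp add: AutoGroup_def BijGroup_def auto_def)

context group
begin

lemma conj_by_in_auto:
  assumes g: "g \<in> carrier G"
  shows "conj_by G g \<in> auto G"
proof -
  have canc: "g \<otimes> (inv g \<otimes> x) = x" "inv g \<otimes> (g \<otimes> x) = x" if "x \<in> carrier G" for x
    using that g by (simp_all add: m_assoc[symmetric])
  have "bij_betw (conj_by G g) (carrier G) (carrier G)"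
    by (rule bij_betw_byWitness[where f' = "conj_by G (inv g)"])
       (use g canc in \<open>auto simp: conj_by_def m_assoc\<close>)
  moreover have "inv g \<otimes> (x \<otimes> y) \<otimes> g = inv g \<otimes> x \<otimes> g \<otimes> (inv g \<otimes> y \<otimes> g)"
    if "x \<in> carrier G" "y \<in> carrier G" for x y
  proof -
    have "g \<otimes> (inv g \<otimes> (y \<otimes> g)) = y \<otimes> g"
      using that g by (simp add: m_assoc[symmetric])
    then show ?thesis
      using that g by (simp add: m_assoc)
  qed
  ultimately show ?thesis
    using g by (auto simp: auto_def Bij_def hom_def conj_by_def)
qed

lemma conj_by_mult:
  assumes "g \<in> carrier G" "h \<in> carrier G" "x \<in> carrier G"
  shows "conj_by G g (conj_by G h x) = conj_by G (h \<otimes> g) x"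
  using assms by (simp add: conj_by_def m_assoc inv_mult_group)

lemma sylow_subgroup_image:
  assumes \<sigma>: "\<sigma> \<in> auto G" and P: "sylow_subgroup p P G"
  shows "sylow_subgroup p (\<sigma> ` P) G"
proof -
  interpret \<sigma>: group_hom G G \<sigma>
    using \<sigma> by (simp add: group_hom_def group_hom_axioms_def auto_def is_group)
  have sub: "subgroup P G" and PG: "P \<subseteq> carrier G"
    using P subgroup.subset by (auto simp: sylow_subgroup_def)
  have "inj_on \<sigma> P"
    using \<sigma> PG by (auto simp: auto_def Bij_def bij_betw_def intro: inj_on_subset)
  then show ?thesis
    using P \<sigma>.subgroup_img_is_subgroup[OF sub]
    by (simp add: sylow_subgroup_def card_image)
qed

lemma inv_AutoGroup:
  assumes "\<sigma> \<in> auto G"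
  shows "inv\<^bsub>AutoGroup G\<^esub> \<sigma> \<in> auto G"
    and "x \<in> carrier G \<Longrightarrow> \<sigma> ((inv\<^bsub>AutoGroup G\<^esub> \<sigma>) x) = x"
    and "x \<in> carrier G \<Longrightarrow> (inv\<^bsub>AutoGroup G\<^esub> \<sigma>) (\<sigma> x) = x"
proof -
  interpret Au: group "AutoGroup G" by (rule AutoGroup)
  have c: "\<sigma> \<in> carrier (AutoGroup G)"
    using assms by (simp add: AutoGroup_def)
  show i: "inv\<^bsub>AutoGroup G\<^esub> \<sigma> \<in> auto G"
    using Au.inv_closed[OF c] by (simp add: AutoGroup_def)
  have o: "\<one>\<^bsub>AutoGroup G\<^esub> = (\<lambda>x\<in>carrier G. x)"
    by (simp add: AutoGroup_def BijGroup_def)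
  show "\<sigma> ((inv\<^bsub>AutoGroup G\<^esub> \<sigma>) x) = x" if x: "x \<in> carrier G"
    using fun_cong[OF Au.r_inv[OF c], of x] x
    by (simp add: mult_AutoGroup[OF assms i] o compose_def)
  show "(inv\<^bsub>AutoGroup G\<^esub> \<sigma>) (\<sigma> x) = x" if x: "x \<in> carrier G"
    using fun_cong[OF Au.l_inv[OF c], of x] x
    by (simp add: mult_AutoGroup[OF i assms] o compose_def)
qed

lemma subgroup_coleman_auto: "subgroup (coleman_auto G) (AutoGroup G)"
proof (rule group.subgroupI[OF AutoGroup])
  show "coleman_auto G \<subseteq> carrier (AutoGroup G)"
    by (auto simp: coleman_auto_def AutoGroup_def)
  have "(\<lambda>x\<in>carrier G. x) \<in> coleman_auto G"
    by (auto simp: coleman_auto_def id_in_auto sylow_subgroup_def conj_by_def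
        intro!: bexI[of _ \<one>] dest: subgroup.mem_carrier)
  then show "coleman_auto G \<noteq> {}" by blast
next
  fix \<sigma> assume s: "\<sigma> \<in> coleman_auto G"
  then have sa: "\<sigma> \<in> auto G" by (simp add: coleman_auto_def)
  let ?\<tau> = "inv\<^bsub>AutoGroup G\<^esub> \<sigma>"
  have "\<exists>g\<in>carrier G. \<forall>x\<in>P. ?\<tau> x = conj_by G g x"
    if p: "prime p" "p dvd order G" and P: "sylow_subgroup p P G" for p P
  proof -
    have PG: "P \<subseteq> carrier G"
      using P subgroup.subset by (auto simp: sylow_subgroup_def)
    obtain g where g: "g \<in> carrier G" "\<And>x. x \<in> ?\<tau> ` P \<Longrightarrow> \<sigma> x = conj_by G g x"
      using coleman_autoD[OF s p sylow_subgroup_image[OF inv_AutoGroup(1)[OF sa] P]] by metis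
    have "?\<tau> x = conj_by G (inv g) x" if x: "x \<in> P" for x
    proof -
      have tx: "?\<tau> x \<in> carrier G"
        using inv_AutoGroup(1)[OF sa] x PG by (auto simp: auto_def hom_def)
      have "x = conj_by G g (?\<tau> x)"
        using g(2)[of "?\<tau> x"] inv_AutoGroup(2)[OF sa subsetD[OF PG x]] x by simp
      then have "conj_by G (inv g) x = conj_by G (g \<otimes> inv g) (?\<tau> x)"
        using conj_by_mult[of "inv g" g "?\<tau> x"] g(1) tx by simp
      then show ?thesis
        using g(1) tx by (simp add: conj_by_def)
    qed
    then show ?thesis using g(1) by blast
  qed
  then show "?\<tau> \<in> coleman_auto G"
    using inv_AutoGroup(1)[OF sa] by (intro coleman_autoI)
next
  fix \<sigma> \<tau> assume s: "\<sigma> \<in> coleman_auto G" and t: "\<tau> \<in> coleman_auto G"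
  then have a: "\<sigma> \<in> auto G" "\<tau> \<in> auto G" by (simp_all add: coleman_auto_def)
  have "\<exists>g\<in>carrier G. \<forall>x\<in>P. compose (carrier G) \<sigma> \<tau> x = conj_by G g x"
    if p: "prime p" "p dvd order G" and P: "sylow_subgroup p P G" for p P
  proof -
    have PG: "P \<subseteq> carrier G"
      using P subgroup.subset by (auto simp: sylow_subgroup_def)
    obtain h where h: "h \<in> carrier G" "\<And>x. x \<in> P \<Longrightarrow> \<tau> x = conj_by G h x"
      using coleman_autoD[OF t p P] by metis
    obtain g where g: "g \<in> carrier G" "\<And>x. x \<in> \<tau> ` P \<Longrightarrow> \<sigma> x = conj_by G g x"
      using coleman_autoD[OF s p sylow_subgroup_image[OF a(2) P]] by metis
    have "compose (carrier G) \<sigma> \<tau> x = conj_by G (h \<otimes> g) x" if x: "x \<in> P" for x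
      using g(2)[OF imageI[OF x]] h(2)[OF x] conj_by_mult[OF g(1) h(1), of x] x subsetD[OF PG x]
      by (simp add: compose_def)
    then show ?thesis using g(1) h(1) by blast
  qed
  moreover have "\<sigma> \<otimes>\<^bsub>AutoGroup G\<^esub> \<tau> \<in> carrier (AutoGroup G)"
    using a by (intro monoid.m_closed[OF group.is_monoid[OF AutoGroup]]) (simp_all add: AutoGroup_def)
  then have "compose (carrier G) \<sigma> \<tau> \<in> auto G"
    unfolding mult_AutoGroup[OF a] by (simp add: AutoGroup_def)
  ultimately show "\<sigma> \<otimes>\<^bsub>AutoGroup G\<^esub> \<tau> \<in> coleman_auto G"
    unfolding mult_AutoGroup[OF a] by (intro coleman_autoI)
qed

lemma group_Aut_col: "group (Aut_col G)"
  unfolding Aut_col_def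
  by (rule subgroup.subgroup_is_group[OF subgroup_coleman_auto AutoGroup])

lemma Inn_subset_coleman_auto: "Inn G \<subseteq> coleman_auto G"
  unfolding Inn_def by (intro image_subsetI coleman_autoI conj_by_in_auto) blast+

lemma auto_conj_by:
  assumes "\<sigma> \<in> auto G" "g \<in> carrier G" "x \<in> carrier G"
  shows "\<sigma> (conj_by G g x) = conj_by G (\<sigma> g) (\<sigma> x)"
proof -
  interpret \<sigma>: group_hom G G \<sigma>
    using assms by (simp add: group_hom_def group_hom_axioms_def auto_def is_group)
  show ?thesis using assms by (simp add: conj_by_def)
qed

lemma normal_Inn: "Inn G \<lhd> Aut_col G"
proof -
  interpret C: group "Aut_col G" by (rule group_Aut_col)
  have car: "carrier (Aut_col G) = coleman_auto G" by (simp add: Aut_col_def)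
  have co: "\<sigma> \<in> auto G" if "\<sigma> \<in> coleman_auto G" for \<sigma>
    using that by (simp add: coleman_auto_def)
  have mu: "\<sigma> \<otimes>\<^bsub>Aut_col G\<^esub> \<tau> = compose (carrier G) \<sigma> \<tau>"
    if "\<sigma> \<in> coleman_auto G" "\<tau> \<in> coleman_auto G" for \<sigma> \<tau>
    using mult_AutoGroup[OF co co, OF that] by (simp add: Aut_col_def)
  have cc: "compose (carrier G) (conj_by G g) (conj_by G h) = conj_by G (h \<otimes> g)"
    if "g \<in> carrier G" "h \<in> carrier G" for g h
    using that conj_by_mult[OF that]
    by (intro extensionalityI[of _ "carrier G"]) (auto simp: compose_def conj_by_def)
  have ic: "conj_by G g \<in> coleman_auto G" if "g \<in> carrier G" for g
    using that Inn_subset_coleman_auto by (auto simp: Inn_def)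
  have one: "\<one>\<^bsub>Aut_col G\<^esub> = conj_by G \<one>"
    by (auto simp: Aut_col_def AutoGroup_def BijGroup_def conj_by_def)
  have sub: "subgroup (Inn G) (Aut_col G)"
  proof (rule C.subgroupI)
    show "Inn G \<subseteq> carrier (Aut_col G)" using Inn_subset_coleman_auto car by simp
    show "Inn G \<noteq> {}" by (auto simp: Inn_def)
    fix \<sigma> assume "\<sigma> \<in> Inn G"
    then obtain g where g: "g \<in> carrier G" "\<sigma> = conj_by G g" by (auto simp: Inn_def)
    have "conj_by G (inv g) \<otimes>\<^bsub>Aut_col G\<^esub> \<sigma> = \<one>\<^bsub>Aut_col G\<^esub>"
      using g by (simp add: mu ic cc one)
    then have "inv\<^bsub>Aut_col G\<^esub> \<sigma> = conj_by G (inv g)"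
      using g ic by (intro C.inv_equality) (simp_all add: car)
    then show "inv\<^bsub>Aut_col G\<^esub> \<sigma> \<in> Inn G" using g by (simp add: Inn_def)
  next
    fix \<sigma> \<tau> assume "\<sigma> \<in> Inn G" "\<tau> \<in> Inn G"
    then show "\<sigma> \<otimes>\<^bsub>Aut_col G\<^esub> \<tau> \<in> Inn G"
      by (auto simp: Inn_def mu ic cc)
  qed
  show ?thesis
  proof (rule C.normal_invI[OF sub])
    fix \<sigma> h assume s: "\<sigma> \<in> carrier (Aut_col G)" and "h \<in> Inn G"
    then obtain g where g: "g \<in> carrier G" "h = conj_by G g" by (auto simp: Inn_def)
    have s': "\<sigma> \<in> coleman_auto G" using s car by simp
    have sg: "\<sigma> g \<in> carrier G" using co[OF s'] g by (auto simp: auto_def hom_def)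
    have "\<sigma> \<otimes>\<^bsub>Aut_col G\<^esub> h = conj_by G (\<sigma> g) \<otimes>\<^bsub>Aut_col G\<^esub> \<sigma>"
    proof -
      have "compose (carrier G) \<sigma> (conj_by G g) = compose (carrier G) (conj_by G (\<sigma> g)) \<sigma>"
        using auto_conj_by[OF co[OF s'] g(1)]
        by (intro extensionalityI[of _ "carrier G"]) (auto simp: compose_def)
      then show ?thesis using s' g sg by (simp add: mu ic)
    qed
    then have "\<sigma> \<otimes>\<^bsub>Aut_col G\<^esub> h \<otimes>\<^bsub>Aut_col G\<^esub> inv\<^bsub>Aut_col G\<^esub> \<sigma> = conj_by G (\<sigma> g)"
      using s ic[OF sg, folded car] by (simp add: C.m_assoc)
    then show "\<sigma> \<otimes>\<^bsub>Aut_col G\<^esub> h \<otimes>\<^bsub>Aut_col G\<^esub> inv\<^bsub>Aut_col G\<^esub> \<sigma> \<in> Inn G"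
      using sg by (simp add: Inn_def)
  qed
qed

lemma group_Out_col: "group (Out_col G)"
  unfolding Out_col_def by (rule normal.factorgroup_is_group[OF normal_Inn])

end

text \<open>The outer semidirect product of \<open>A\<close> by \<open>B\<close> for an action \<open>\<phi> \<in> hom B (AutoGroup A)\<close>;
  the product in \<^const>\<open>AutoGroup\<close> is \<open>f \<circ> g\<close>, so this is a left action of \<open>B\<close> on \<open>A\<close>.\<close>

definition semidirect ::
  "('a, 'm) monoid_scheme \<Rightarrow> ('b, 'n) monoid_scheme \<Rightarrow> ('b \<Rightarrow> 'a \<Rightarrow> 'a) \<Rightarrow> ('a \<times> 'b) monoid" where
  "semidirect A B \<phi> =
    \<lparr>carrier = carrier A \<times> carrier B,
     monoid.mult = (\<lambda>(a, b) (a', b'). (a \<otimes>\<^bsub>A\<^esub> \<phi> b a', b \<otimes>\<^bsub>B\<^esub> b')),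
     one = (\<one>\<^bsub>A\<^esub>, \<one>\<^bsub>B\<^esub>)\<rparr>"

lemma group_semidirect:
  assumes "group A" "group B" and \<phi>: "\<phi> \<in> hom B (AutoGroup A)"
  shows "group (semidirect A B \<phi>)"
proof -
  interpret A: group A by fact
  interpret B: group B by fact
  interpret h: group_hom B "AutoGroup A" \<phi>
    using \<phi> by (simp add: group_hom_def group_hom_axioms_def A.AutoGroup B.is_group)
  have au: "\<phi> b \<in> auto A" if "b \<in> carrier B" for b
    using h.hom_closed[OF that] by (simp add: AutoGroup_def)
  have cl: "\<phi> b x \<in> carrier A" if "b \<in> carrier B" "x \<in> carrier A" for b x
    using au[OF that(1)] that(2) by (auto simp: auto_def hom_def)
  have mu: "\<phi> b (x \<otimes>\<^bsub>A\<^esub> y) = \<phi> b x \<otimes>\<^bsub>A\<^esub> \<phi> b y"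
    if "b \<in> carrier B" "x \<in> carrier A" "y \<in> carrier A" for b x y
    using au[OF that(1)] that(2,3) by (auto simp: auto_def hom_def)
  have co: "\<phi> (b \<otimes>\<^bsub>B\<^esub> c) x = \<phi> b (\<phi> c x)"
    if "b \<in> carrier B" "c \<in> carrier B" "x \<in> carrier A" for b c x
    using h.hom_mult[OF that(1,2)] au[OF that(1)] au[OF that(2)] that(3)
    by (simp add: AutoGroup_def BijGroup_def auto_def compose_def)
  have on: "\<phi> \<one>\<^bsub>B\<^esub> x = x" if "x \<in> carrier A" for x
    using h.hom_one that by (simp add: AutoGroup_def BijGroup_def)
  show ?thesis
  proof (rule groupI)
    fix x assume "x \<in> carrier (semidirect A B \<phi>)"
    then obtain a b where x: "x = (a, b)" "a \<in> carrier A" "b \<in> carrier B"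
      by (auto simp: semidirect_def)
    let ?y = "(\<phi> (inv\<^bsub>B\<^esub> b) (inv\<^bsub>A\<^esub> a), inv\<^bsub>B\<^esub> b)"
    have "?y \<otimes>\<^bsub>semidirect A B \<phi>\<^esub> x = \<one>\<^bsub>semidirect A B \<phi>\<^esub>"
      using x on[of "\<one>\<^bsub>A\<^esub>"] co[of "inv\<^bsub>B\<^esub> b" b "\<one>\<^bsub>A\<^esub>"]
        mu[of "inv\<^bsub>B\<^esub> b" "inv\<^bsub>A\<^esub> a" a] mu[of "inv\<^bsub>B\<^esub> b" "\<one>\<^bsub>A\<^esub>" "\<one>\<^bsub>A\<^esub>"]
        cl[of "inv\<^bsub>B\<^esub> b" "\<one>\<^bsub>A\<^esub>"]
      by (simp add: semidirect_def)
    then show "\<exists>y\<in>carrier (semidirect A B \<phi>). y \<otimes>\<^bsub>semidirect A B \<phi>\<^esub> x = \<one>\<^bsub>semidirect A B \<phi>\<^esub>"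
      using x cl[of "inv\<^bsub>B\<^esub> b" "inv\<^bsub>A\<^esub> a"] by (intro bexI[of _ ?y]) (auto simp: semidirect_def simp del: h.hom_inv)
  qed (auto simp: semidirect_def cl mu co on A.m_assoc B.m_assoc simp del: h.hom_mult h.hom_one)
qed

end

theory Submission
  imports Defs "HOL-Algebra.Multiplicative_Group" "HOL-Algebra.Weak_Morphisms"
    "HOL-Algebra.Product_Groups" "HOL-Number_Theory.Cong"
begin

text \<open>
  The group is the wreath product of the cyclic group of order \<open>p r\<close> by \<open>H\<close>, where \<open>p\<close> and \<open>r\<close> are
  distinct primes larger than \<open>|H|\<close>: take \<open>B = H\<close>, and let it translate the functions from \<open>H\<close> to
  the integers modulo \<open>p r\<close>, which form \<open>A\<close>. What matters about this action is that \<open>B\<close> is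
  faithful on each of the two Sylow subgroups \<open>A\<^sub>p\<close> and \<open>A\<^sub>r\<close> of \<open>A\<close>, and that \<open>|A|\<close> and \<open>|B|\<close> are
  coprime. For all such actions \<open>Out\<^sub>c\<^sub>o\<^sub>l(A \<rtimes> B)\<close> is isomorphic to \<open>B\<close> (\<open>Out_col_iso\<close>), for the
  following reason.

  Inner automorphisms of \<open>G = A \<rtimes> B\<close> move \<open>A\<^sub>p\<close> and \<open>A\<^sub>r\<close> by one and the same element of \<open>B\<close>, whereas
  a Coleman automorphism may move them by two different elements; the quotient of these two
  elements is the only invariant modulo inner automorphisms. In detail, for \<open>c\<close> in \<open>B\<close> let
  \<open>twist_auto c\<close> act as \<open>c\<close> on \<open>A\<^sub>p\<close> and trivially on \<open>A\<^sub>r\<close> and on \<open>B\<close>. As \<open>B\<close> is abelian, this is an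
  automorphism.

  \<^item> It is Coleman (\<open>twist_auto_coleman\<close>): on \<open>A\<^sub>p\<close> and \<open>A\<^sub>r\<close> it is conjugation by an element of \<open>B\<close>,
    and every other Sylow subgroup is conjugate to a subgroup of \<open>B\<close>, which is fixed pointwise.
  \<^item> It is inner only for \<open>c = 1\<close> (\<open>twist_auto_inner_imp_one\<close>): an inner automorphism trivial on \<open>A\<^sub>r\<close>
    is conjugation by an element of \<open>A\<close>, by faithfulness, hence trivial on \<open>A\<^sub>p\<close>.
  \<^item> Up to inner automorphisms there are no others (\<open>coleman_normal_form\<close>): a Coleman automorphism
    acts on \<open>A\<^sub>p\<close> and on \<open>A\<^sub>r\<close> like elements of \<open>B\<close>; by faithfulness it is then trivial on \<open>G/A\<close>, so it
    moves \<open>B\<close> by a cocycle with values in \<open>A\<close>, and by coprimality this is a coboundary.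

  The last point and the conjugacy of Sylow subgroups both rest on the vanishing of the first
  cohomology of subgroups of \<open>B\<close> in \<open>A\<close> (\<open>cocycle_is_coboundary\<close>).
\<close>

section \<open>Torsion in finite groups\<close>

lemma (in group) coprime_pow_eq_one:
  assumes "x \<in> carrier G" "x [^] (m::nat) = \<one>" "x [^] (n::nat) = \<one>" "coprime m n"
  shows "x = \<one>"
proof -
  have "ord x dvd m" "ord x dvd n"
    using assms by (simp_all add: pow_eq_id)
  then have "ord x = 1"
    using \<open>coprime m n\<close> by (metis coprime_common_divisor_nat nat_dvd_1_iff_1)
  then show ?thesis
    using pow_ord_eq_1[OF assms(1)] assms(1) by simp
qed

lemma (in group) pow_cong_exponent:
  assumes x: "x \<in> carrier G" "x [^] d = \<one>" and "[m = n] (mod d)"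
  shows "x [^] m = x [^] (n::nat)"
proof -
  have *: "x [^] k = x [^] (k mod d)" for k :: nat
  proof -
    have "x [^] k = x [^] (d * (k div d) + k mod d)"
      by simp
    also have "\<dots> = (x [^] d) [^] (k div d) \<otimes> x [^] (k mod d)"
      using x(1) by (simp only: nat_pow_mult nat_pow_pow nat_pow_closed)
    finally show ?thesis
      using x by simp
  qed
  show ?thesis
    using *[of m] *[of n] assms(3) by (simp add: cong_def)
qed

text \<open>
  The torsion subgroup is the Sylow subgroup \<open>S\<close>: an element \<open>x\<close> of order dividing \<open>p ^ k\<close> is a power
  of \<open>x [^] m\<close>, and this lies in \<open>S\<close> because \<open>m\<close> is the order of the quotient by \<open>S\<close>.
\<close>
lemma (in comm_group) card_torsion_prime_part:
  assumes "finite (carrier G)" "prime p" "order G = p ^ k * m" "coprime (p ^ k) m"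
  shows "card {x \<in> carrier G. x [^] (p ^ k) = \<one>} = p ^ k"
proof -
  obtain S where S: "subgroup S G" "card S = p ^ k"
    using sylow_thm[OF assms(2) is_group assms(3,1)] by blast
  interpret S: normal S G
    using S(1) by (rule subgroup_imp_normal)
  interpret Q: group "G Mod S"
    by (rule S.factorgroup_is_group)
  interpret h: group_hom G "G Mod S" "\<lambda>x. S #> x"
    using S.r_coset_hom_Mod by (simp add: group_hom_def group_hom_axioms_def is_group Q.is_group)
  have "p ^ k * m = order (G Mod S) * p ^ k"
    using lagrange[OF S(1)] S(2) assms(3) by (metis FactGroup_def order_def partial_object.select_convs(1))
  then have ord: "order (G Mod S) = m"
    using prime_gt_0_nat[OF assms(2)] by simp
  have "x \<in> S \<longleftrightarrow> x [^] (p ^ k) = \<one>" if x: "x \<in> carrier G" for x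
  proof
    assume xS: "x \<in> S"
    interpret SG: group "G\<lparr>carrier := S\<rparr>" using S.subgroup_is_group[OF is_group] .
    show "x [^] (p ^ k) = \<one>"
      using SG.pow_order_eq_1[of x] xS S(2) by (simp add: order_def nat_pow_consistent[symmetric])
  next
    assume xp: "x [^] (p ^ k) = \<one>"
    have "S #> (x [^] m) = \<one>\<^bsub>G Mod S\<^esub>"
      using h.hom_nat_pow[OF x, of m] Q.pow_order_eq_1[OF h.hom_closed[OF x]] ord by simp
    then have xm: "x [^] m \<in> S"
      using x S(1) coset_join1[of S "x [^] m"] by (simp add: FactGroup_def)
    obtain N where N: "[m * N = 1] (mod p ^ k)"
      using cong_solve_coprime_nat[of m "p ^ k"] assms(4) by (auto simp: coprime_commute)
    have "x = (x [^] m) [^] N"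
      using pow_cong_exponent[OF x xp N] x by (simp add: nat_pow_pow)
    moreover have "(x [^] m) [^] N \<in> S"
      by (induction N) (use xm in auto)
    ultimately show "x \<in> S" by simp
  qed
  then have "{x \<in> carrier G. x [^] (p ^ k) = \<one>} = S"
    using S.subset by auto
  then show ?thesis using S(2) by simp
qed

section \<open>Semidirect products of abelian groups of coprime orders\<close>

locale coprime_action = A: comm_group A + B: comm_group B
  for A :: "('a, 'm) monoid_scheme" and B :: "('b, 'n) monoid_scheme" +
  fixes \<phi> :: "'b \<Rightarrow> 'a \<Rightarrow> 'a"
  assumes finite_A: "finite (carrier A)" and finite_B: "finite (carrier B)"
    and action: "\<phi> \<in> hom B (AutoGroup A)"
    and coprime_orders: "coprime (order A) (order B)"
begin

abbreviation "G \<equiv> semidirect A B \<phi>"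

lemma act_auto: "b \<in> carrier B \<Longrightarrow> \<phi> b \<in> auto A"
  using action by (auto simp: hom_def AutoGroup_def)

lemma act_closed [simp]: "b \<in> carrier B \<Longrightarrow> x \<in> carrier A \<Longrightarrow> \<phi> b x \<in> carrier A"
  using act_auto[of b] by (auto simp: auto_def hom_def)

lemma act_mult [simp]:
  "b \<in> carrier B \<Longrightarrow> x \<in> carrier A \<Longrightarrow> y \<in> carrier A \<Longrightarrow> \<phi> b (x \<otimes>\<^bsub>A\<^esub> y) = \<phi> b x \<otimes>\<^bsub>A\<^esub> \<phi> b y"
  using act_auto[of b] by (auto simp: auto_def hom_def)

lemma act_act:
  "b \<in> carrier B \<Longrightarrow> c \<in> carrier B \<Longrightarrow> x \<in> carrier A \<Longrightarrow> \<phi> b (\<phi> c x) = \<phi> (b \<otimes>\<^bsub>B\<^esub> c) x"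
  using hom_mult[OF action, of b c] by (simp add: mult_AutoGroup act_auto compose_def)

lemma act_commute:
  "b \<in> carrier B \<Longrightarrow> c \<in> carrier B \<Longrightarrow> x \<in> carrier A \<Longrightarrow> \<phi> b (\<phi> c x) = \<phi> c (\<phi> b x)"
  by (simp add: act_act B.m_comm)

lemma act_group_hom: "b \<in> carrier B \<Longrightarrow> group_hom A A (\<phi> b)"
  by (auto simp: group_hom_def group_hom_axioms_def A.is_group hom_def)

lemma act_by_one [simp]: "x \<in> carrier A \<Longrightarrow> \<phi> \<one>\<^bsub>B\<^esub> x = x"
proof -
  interpret h: group_hom B "AutoGroup A" \<phi>
    using action by (simp add: group_hom_def group_hom_axioms_def A.AutoGroup B.is_group)
  show "x \<in> carrier A \<Longrightarrow> ?thesis"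
    using h.hom_one by (simp add: AutoGroup_def BijGroup_def)
qed

lemma act_one [simp]: "b \<in> carrier B \<Longrightarrow> \<phi> b \<one>\<^bsub>A\<^esub> = \<one>\<^bsub>A\<^esub>"
  using group_hom.hom_one[OF act_group_hom] .

lemma act_inv [simp]: "b \<in> carrier B \<Longrightarrow> x \<in> carrier A \<Longrightarrow> \<phi> b (inv\<^bsub>A\<^esub> x) = inv\<^bsub>A\<^esub> \<phi> b x"
  using group_hom.hom_inv[OF act_group_hom] by metis

lemma act_pow: "b \<in> carrier B \<Longrightarrow> x \<in> carrier A \<Longrightarrow> \<phi> b (x [^]\<^bsub>A\<^esub> n) = \<phi> b x [^]\<^bsub>A\<^esub> (n::nat)"
  using group_hom.hom_nat_pow[OF act_group_hom] by metis

lemma act_inv_cancel [simp]: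
  assumes "b \<in> carrier B" "x \<in> carrier A"
  shows "\<phi> (inv\<^bsub>B\<^esub> b) (\<phi> b x) = x" "\<phi> b (\<phi> (inv\<^bsub>B\<^esub> b) x) = x"
  using assms by (simp_all add: act_act)

lemma act_finprod:
  assumes "b \<in> carrier B" "f \<in> S \<rightarrow> carrier A"
  shows "\<phi> b (finprod A f S) = finprod A (\<lambda>i. \<phi> b (f i)) S"
  using assms(2)
proof (induction S rule: infinite_finite_induct)
  case (insert x S)
  then have "f \<in> S \<rightarrow> carrier A" "f x \<in> carrier A" by auto
  moreover have "(\<lambda>i. \<phi> b (f i)) \<in> S \<rightarrow> carrier A"
    using insert.prems assms(1) by (simp add: Pi_iff)
  ultimately show ?case
    using insert assms(1) by simp
qed (use assms(1) in auto)

lemma carrier_G [simp]: "carrier G = carrier A \<times> carrier B"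
  by (simp add: semidirect_def)

lemma mult_G [simp]: "(a, b) \<otimes>\<^bsub>G\<^esub> (a', b') = (a \<otimes>\<^bsub>A\<^esub> \<phi> b a', b \<otimes>\<^bsub>B\<^esub> b')"
  by (simp add: semidirect_def)

lemma one_G [simp]: "\<one>\<^bsub>G\<^esub> = (\<one>\<^bsub>A\<^esub>, \<one>\<^bsub>B\<^esub>)"
  by (simp add: semidirect_def)

sublocale G: group G
  using group_semidirect[OF A.is_group B.is_group action] .

lemma order_G: "order G = order A * order B"
  by (simp add: order_def card_cartesian_product)

lemma inv_G:
  assumes "a \<in> carrier A" "b \<in> carrier B"
  shows "inv\<^bsub>G\<^esub> (a, b) = (inv\<^bsub>A\<^esub> \<phi> (inv\<^bsub>B\<^esub> b) a, inv\<^bsub>B\<^esub> b)"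
  using assms by (intro G.inv_equality) simp_all

lemma group_hom_incl: "group_hom A G (\<lambda>a. (a, \<one>\<^bsub>B\<^esub>))"
  by (auto simp: group_hom_def group_hom_axioms_def A.is_group G.is_group hom_def)

lemma group_hom_snd: "group_hom G B snd"
  by (auto simp: group_hom_def group_hom_axioms_def B.is_group G.is_group hom_def)

lemma pow_incl: "a \<in> carrier A \<Longrightarrow> (a, \<one>\<^bsub>B\<^esub>) [^]\<^bsub>G\<^esub> (n::nat) = (a [^]\<^bsub>A\<^esub> n, \<one>\<^bsub>B\<^esub>)"
  using group_hom.hom_nat_pow[OF group_hom_incl] by metis

lemma snd_pow: "g \<in> carrier G \<Longrightarrow> snd (g [^]\<^bsub>G\<^esub> (n::nat)) = snd g [^]\<^bsub>B\<^esub> n"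
  using group_hom.hom_nat_pow[OF group_hom_snd] by metis

text \<open>
  The second component is unchanged because \<open>B\<close> is abelian. The formula separates the two kinds of
  inner automorphism: \<open>b\<close> acts on \<open>A\<close>, and \<open>a\<close> shifts \<open>B\<close> by the coboundary of \<open>a\<close>.
\<close>
lemma conj_by_G:
  assumes "a \<in> carrier A" "b \<in> carrier B" "x \<in> carrier A" "h \<in> carrier B"
  shows "conj_by G (a, b) (x, h) = (\<phi> (inv\<^bsub>B\<^esub> b) (inv\<^bsub>A\<^esub> a \<otimes>\<^bsub>A\<^esub> x \<otimes>\<^bsub>A\<^esub> \<phi> h a), h)"
proof -
  have "inv\<^bsub>B\<^esub> b \<otimes>\<^bsub>B\<^esub> h \<otimes>\<^bsub>B\<^esub> b = h"
    using assms by (simp add: B.m_comm[of _ b] B.m_assoc[symmetric])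
  then show ?thesis
    using assms by (simp add: conj_by_def inv_G act_act)
qed

text \<open>
  Averaging: the product \<open>s\<close> of all values of \<open>\<alpha>\<close> satisfies \<open>s = \<alpha>(h)^|Q| h(s)\<close>, so \<open>\<alpha>(h)^|Q|\<close> is the
  coboundary of \<open>s\<^sup>-\<^sup>1\<close>. As \<open>|Q|\<close> has an inverse \<open>N\<close> modulo \<open>|A|\<close>, the power with exponent \<open>N\<close>
  recovers \<open>\<alpha>(h)\<close>.
\<close>
lemma cocycle_is_coboundary:
  assumes Q: "subgroup Q B"
    and \<alpha>: "\<And>h. h \<in> Q \<Longrightarrow> \<alpha> h \<in> carrier A"
    and cocycle: "\<And>h k. h \<in> Q \<Longrightarrow> k \<in> Q \<Longrightarrow> \<alpha> (h \<otimes>\<^bsub>B\<^esub> k) = \<alpha> h \<otimes>\<^bsub>A\<^esub> \<phi> h (\<alpha> k)"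
  obtains a where "a \<in> carrier A" "\<And>h. h \<in> Q \<Longrightarrow> \<alpha> h = inv\<^bsub>A\<^esub> a \<otimes>\<^bsub>A\<^esub> \<phi> h a"
proof -
  interpret Q: subgroup Q B by fact
  have "card Q dvd order B"
    using B.lagrange[OF Q] by (metis dvd_triv_right)
  then have "coprime (card Q) (order A)"
    using coprime_orders by (meson coprime_commute coprime_divisors dvd_refl)
  then obtain N where N: "[card Q * N = 1] (mod order A)"
    using cong_solve_coprime_nat[of "card Q" "order A"] by auto
  define s where "s = finprod A \<alpha> Q"
  have s: "s \<in> carrier A"
    unfolding s_def by (intro A.finprod_closed) (use \<alpha> in auto)
  define a where "a = inv\<^bsub>A\<^esub> s [^]\<^bsub>A\<^esub> N"
  have a: "a \<in> carrier A" using s by (simp add: a_def)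
  moreover have "\<alpha> h = inv\<^bsub>A\<^esub> a \<otimes>\<^bsub>A\<^esub> \<phi> h a" if h: "h \<in> Q" for h
  proof -
    have hB: "h \<in> carrier B" using h by auto
    have \<phi>\<alpha>: "(\<lambda>k. \<phi> h (\<alpha> k)) \<in> Q \<rightarrow> carrier A"
      using \<alpha> hB by auto
    have bij: "(\<lambda>k. h \<otimes>\<^bsub>B\<^esub> k) ` Q = Q" "inj_on (\<lambda>k. h \<otimes>\<^bsub>B\<^esub> k) Q"
    proof -
      show inj: "inj_on (\<lambda>k. h \<otimes>\<^bsub>B\<^esub> k) Q"
        using hB by (auto intro!: inj_onI)
      have "(\<lambda>k. h \<otimes>\<^bsub>B\<^esub> k) ` Q \<subseteq> Q" using h by auto
      then show "(\<lambda>k. h \<otimes>\<^bsub>B\<^esub> k) ` Q = Q"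
        using inj finite_subset[OF Q.subset finite_B] by (simp add: endo_inj_surj)
    qed
    have "s = finprod A (\<lambda>k. \<alpha> (h \<otimes>\<^bsub>B\<^esub> k)) Q"
      using A.finprod_reindex[of \<alpha> "\<lambda>k. h \<otimes>\<^bsub>B\<^esub> k" Q] bij \<alpha> by (simp add: s_def Pi_iff)
    also have "\<dots> = finprod A (\<lambda>k. \<alpha> h \<otimes>\<^bsub>A\<^esub> \<phi> h (\<alpha> k)) Q"
      using h \<alpha> \<phi>\<alpha> by (intro A.finprod_cong') (auto simp: cocycle)
    also have "\<dots> = finprod A (\<lambda>k. \<alpha> h) Q \<otimes>\<^bsub>A\<^esub> finprod A (\<lambda>k. \<phi> h (\<alpha> k)) Q"
      using h \<alpha> \<phi>\<alpha> by (intro A.finprod_multf) auto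
    also have "\<dots> = \<alpha> h [^]\<^bsub>A\<^esub> card Q \<otimes>\<^bsub>A\<^esub> \<phi> h s"
      using h \<alpha> hB by (simp add: A.finprod_const s_def act_finprod Pi_iff)
    finally have "s \<otimes>\<^bsub>A\<^esub> inv\<^bsub>A\<^esub> \<phi> h s = \<alpha> h [^]\<^bsub>A\<^esub> card Q"
      using h \<alpha> hB s by (metis A.inv_solve_right act_closed A.nat_pow_closed A.m_closed)
    then have "(s \<otimes>\<^bsub>A\<^esub> inv\<^bsub>A\<^esub> \<phi> h s) [^]\<^bsub>A\<^esub> N = \<alpha> h [^]\<^bsub>A\<^esub> (card Q * N)"
      using h \<alpha> by (simp add: A.nat_pow_pow)
    also have "\<dots> = \<alpha> h"
      using A.pow_cong_exponent[OF _ _ N] A.pow_order_eq_1 h \<alpha> by simp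
    finally show ?thesis
      using s hB by (simp add: a_def act_pow A.nat_pow_distrib A.nat_pow_inv)
  qed
  ultimately show thesis using that by blast
qed

text \<open>
  The part of the Schur-Zassenhaus theorem that makes complements conjugate: \<open>P\<close> meets \<open>A\<close>
  trivially, so it is the graph of a function on a subgroup of \<open>B\<close>. This function is a cocycle, and
  writing it as a coboundary conjugates \<open>P\<close> into \<open>B\<close>.
\<close>
lemma coprime_subgroup_conjugate:
  assumes P: "subgroup P G" and cop: "coprime (card P) (order A)"
  obtains a where "a \<in> carrier A"
    "\<And>g. g \<in> P \<Longrightarrow> snd g \<in> carrier B \<and> g = (inv\<^bsub>A\<^esub> a \<otimes>\<^bsub>A\<^esub> \<phi> (snd g) a, snd g)"
proof -
  interpret P: subgroup P G by fact
  have PD: "x \<in> carrier A" "h \<in> carrier B" if "(x, h) \<in> P" for x h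
    using P.mem_carrier[OF that] by auto
  have triv: "x = \<one>\<^bsub>A\<^esub>" if "(x, \<one>\<^bsub>B\<^esub>) \<in> P" for x
  proof -
    interpret PG: group "G\<lparr>carrier := P\<rparr>" using P.subgroup_is_group[OF G.is_group] .
    have "(x, \<one>\<^bsub>B\<^esub>) [^]\<^bsub>G\<^esub> card P = \<one>\<^bsub>G\<^esub>"
      using PG.pow_order_eq_1[of "(x, \<one>\<^bsub>B\<^esub>)"] that
      by (simp add: order_def G.nat_pow_consistent[symmetric])
    then have "x [^]\<^bsub>A\<^esub> card P = \<one>\<^bsub>A\<^esub>"
      using PD[OF that] by (simp add: pow_incl)
    then show ?thesis
      using PD[OF that] cop A.pow_order_eq_1 by (auto intro: A.coprime_pow_eq_one)
  qed
  have uniq: "x = y" if "(x, h) \<in> P" "(y, h) \<in> P" for x y h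
  proof -
    have "(x, h) \<otimes>\<^bsub>G\<^esub> inv\<^bsub>G\<^esub> (y, h) \<in> P" using that by blast
    then have "x \<otimes>\<^bsub>A\<^esub> inv\<^bsub>A\<^esub> y = \<one>\<^bsub>A\<^esub>"
      using PD[OF that(1)] PD[OF that(2)] by (intro triv) (simp add: inv_G act_act)
    then show ?thesis
      using PD[OF that(1)] PD[OF that(2)] A.inv_equality A.inv_inv by fastforce
  qed
  define \<alpha> where "\<alpha> = (\<lambda>h. THE x. (x, h) \<in> P)"
  have \<alpha>: "\<alpha> h = x" if "(x, h) \<in> P" for x h
    unfolding \<alpha>_def using that uniq by blast
  have Q: "subgroup (snd ` P) B"
    using group_hom.subgroup_img_is_subgroup[OF group_hom_snd P] .
  obtain a where a: "a \<in> carrier A" "\<And>h. h \<in> snd ` P \<Longrightarrow> \<alpha> h = inv\<^bsub>A\<^esub> a \<otimes>\<^bsub>A\<^esub> \<phi> h a"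
  proof (rule cocycle_is_coboundary[OF Q, of \<alpha>])
    fix h assume "h \<in> snd ` P"
    then show "\<alpha> h \<in> carrier A" using \<alpha> PD by auto
  next
    fix h k assume "h \<in> snd ` P" "k \<in> snd ` P"
    then obtain x y where xy: "(x, h) \<in> P" "(y, k) \<in> P" by auto
    have "(x \<otimes>\<^bsub>A\<^esub> \<phi> h y, h \<otimes>\<^bsub>B\<^esub> k) \<in> P"
      using P.m_closed[OF xy] by simp
    then show "\<alpha> (h \<otimes>\<^bsub>B\<^esub> k) = \<alpha> h \<otimes>\<^bsub>A\<^esub> \<phi> h (\<alpha> k)"
      using xy \<alpha> by simp
  qed blast
  show thesis
  proof (rule that[OF a(1)])
    fix g assume g: "g \<in> P"
    then have "g = (\<alpha> (snd g), snd g)" using \<alpha>[of "fst g" "snd g"] by simp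
    then show "snd g \<in> carrier B \<and> g = (inv\<^bsub>A\<^esub> a \<otimes>\<^bsub>A\<^esub> \<phi> (snd g) a, snd g)"
      using a(2)[of "snd g"] g PD[of "fst g" "snd g"] by simp
  qed
qed

lemma subgroup_of_order_dividing_A:
  assumes P: "subgroup P G" and d: "card P dvd order A" and g: "g \<in> P"
  obtains x where "x \<in> carrier A" "x [^]\<^bsub>A\<^esub> card P = \<one>\<^bsub>A\<^esub>" "g = (x, \<one>\<^bsub>B\<^esub>)"
proof -
  interpret P: subgroup P G by fact
  interpret PG: group "G\<lparr>carrier := P\<rparr>" using P.subgroup_is_group[OF G.is_group] .
  obtain x h where xh: "g = (x, h)" "x \<in> carrier A" "h \<in> carrier B"
    using P.mem_carrier[OF g] by auto
  have pow: "g [^]\<^bsub>G\<^esub> card P = \<one>\<^bsub>G\<^esub>"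
    using PG.pow_order_eq_1[of g] g by (simp add: order_def G.nat_pow_consistent[symmetric])
  then have "h [^]\<^bsub>B\<^esub> card P = \<one>\<^bsub>B\<^esub>"
    using snd_pow[of g "card P"] xh by simp
  then have "h = \<one>\<^bsub>B\<^esub>"
    using xh(3) B.pow_order_eq_1 coprime_divisors[OF d dvd_refl coprime_orders]
    by (auto intro: B.coprime_pow_eq_one)
  then show thesis
    using that[of x] pow xh by (simp add: pow_incl)
qed

end

section \<open>Two primes and a faithful action on both parts\<close>

text \<open>
  One prime would not suffice: a Coleman automorphism could then be corrected by an inner one to be
  trivial on \<open>A\<close>. With two primes one copy of \<open>B\<close> survives the quotient by the diagonal of
  \<open>B \<times> B\<close>.
\<close>

locale two_prime_action = coprime_action A B \<phi>
  for A :: "('a, 'm) monoid_scheme" and B :: "('b, 'n) monoid_scheme" and \<phi> +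
  fixes p r k l :: nat
  assumes primes: "prime p" "prime r" "p \<noteq> r" and exponents: "0 < k" "0 < l"
    and order_A: "order A = p ^ k * r ^ l"
    and faithful_p: "\<And>b. b \<in> carrier B \<Longrightarrow>
      (\<And>x. x \<in> carrier A \<Longrightarrow> x [^]\<^bsub>A\<^esub> (p ^ k) = \<one>\<^bsub>A\<^esub> \<Longrightarrow> \<phi> b x = x) \<Longrightarrow> b = \<one>\<^bsub>B\<^esub>"
    and faithful_r: "\<And>b. b \<in> carrier B \<Longrightarrow>
      (\<And>x. x \<in> carrier A \<Longrightarrow> x [^]\<^bsub>A\<^esub> (r ^ l) = \<one>\<^bsub>A\<^esub> \<Longrightarrow> \<phi> b x = x) \<Longrightarrow> b = \<one>\<^bsub>B\<^esub>"
begin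

definition "Ap = {x \<in> carrier A. x [^]\<^bsub>A\<^esub> (p ^ k) = \<one>\<^bsub>A\<^esub>}"
definition "Ar = {x \<in> carrier A. x [^]\<^bsub>A\<^esub> (r ^ l) = \<one>\<^bsub>A\<^esub>}"

lemma coprime_parts: "coprime (p ^ k) (r ^ l)"
  using primes by (simp add: primes_coprime)

lemma Ap_carrier: "x \<in> Ap \<Longrightarrow> x \<in> carrier A"
  and Ar_carrier: "x \<in> Ar \<Longrightarrow> x \<in> carrier A"
  by (simp_all add: Ap_def Ar_def)

lemma act_Ap: "b \<in> carrier B \<Longrightarrow> x \<in> Ap \<Longrightarrow> \<phi> b x \<in> Ap"
  and act_Ar: "b \<in> carrier B \<Longrightarrow> x \<in> Ar \<Longrightarrow> \<phi> b x \<in> Ar"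
  by (simp_all add: Ap_def Ar_def act_pow[symmetric])

lemma card_Ap: "card Ap = p ^ k"
  unfolding Ap_def
  by (rule A.card_torsion_prime_part[OF finite_A primes(1) order_A coprime_parts])

lemma card_Ar: "card Ar = r ^ l"
  unfolding Ar_def using coprime_parts
  by (intro A.card_torsion_prime_part[OF finite_A primes(2), of l "p ^ k"])
     (simp_all add: order_A mult.commute coprime_commute)

text \<open>
  Raising to the powers \<open>exp_p\<close> and \<open>exp_r\<close> projects \<open>A\<close> onto its two primary parts. Projections of
  this form commute with every automorphism.
\<close>
definition exp_p where "exp_p = (SOME n::nat. [n = 1] (mod p ^ k) \<and> [n = 0] (mod r ^ l))"
definition exp_r where "exp_r = (SOME n::nat. [n = 0] (mod p ^ k) \<and> [n = 1] (mod r ^ l))"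

lemma exp_p_cong: "[exp_p = 1] (mod p ^ k)" "[exp_p = 0] (mod r ^ l)"
  using someI_ex[OF binary_chinese_remainder_nat[OF coprime_parts, of 1 0]] by (auto simp: exp_p_def)

lemma exp_r_cong: "[exp_r = 0] (mod p ^ k)" "[exp_r = 1] (mod r ^ l)"
  using someI_ex[OF binary_chinese_remainder_nat[OF coprime_parts, of 0 1]] by (auto simp: exp_r_def)

lemma pow_parts_Ap: "x \<in> Ap \<Longrightarrow> x [^]\<^bsub>A\<^esub> exp_p = x" "x \<in> Ap \<Longrightarrow> x [^]\<^bsub>A\<^esub> exp_r = \<one>\<^bsub>A\<^esub>"
  using A.pow_cong_exponent[OF _ _ exp_p_cong(1)] A.pow_cong_exponent[OF _ _ exp_r_cong(1)]
  by (simp_all add: Ap_def)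

lemma pow_parts_Ar: "x \<in> Ar \<Longrightarrow> x [^]\<^bsub>A\<^esub> exp_p = \<one>\<^bsub>A\<^esub>" "x \<in> Ar \<Longrightarrow> x [^]\<^bsub>A\<^esub> exp_r = x"
  using A.pow_cong_exponent[OF _ _ exp_p_cong(2)] A.pow_cong_exponent[OF _ _ exp_r_cong(2)]
  by (simp_all add: Ar_def)

lemma decompose:
  assumes x: "x \<in> carrier A"
  obtains y z where "y \<in> Ap" "z \<in> Ar" "x = y \<otimes>\<^bsub>A\<^esub> z"
proof
  have ord: "x [^]\<^bsub>A\<^esub> (p ^ k * r ^ l) = \<one>\<^bsub>A\<^esub>"
    using A.pow_order_eq_1[OF x] by (simp add: order_A)
  have "[exp_p * p ^ k = 0] (mod p ^ k * r ^ l)" "[exp_r * r ^ l = 0] (mod p ^ k * r ^ l)"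
    using exp_p_cong(2) exp_r_cong(1) by (simp_all add: cong_0_iff mult.commute mult_dvd_mono)
  then show "x [^]\<^bsub>A\<^esub> exp_p \<in> Ap" "x [^]\<^bsub>A\<^esub> exp_r \<in> Ar"
    using x A.pow_cong_exponent[OF x ord] by (simp_all add: Ap_def Ar_def A.nat_pow_pow)
  have "[exp_p + exp_r = 1] (mod p ^ k)" "[exp_p + exp_r = 1] (mod r ^ l)"
    using cong_add[OF exp_p_cong(1) exp_r_cong(1)] cong_add[OF exp_p_cong(2) exp_r_cong(2)] by simp_all
  then have "[exp_p + exp_r = 1] (mod p ^ k * r ^ l)"
    using coprime_parts by (rule coprime_cong_mult_nat)
  then show "x = x [^]\<^bsub>A\<^esub> exp_p \<otimes>\<^bsub>A\<^esub> x [^]\<^bsub>A\<^esub> exp_r"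
    using A.pow_cong_exponent[OF x ord] x by (simp add: A.nat_pow_mult)
qed

definition twist where "twist c x = \<phi> c (x [^]\<^bsub>A\<^esub> exp_p) \<otimes>\<^bsub>A\<^esub> x [^]\<^bsub>A\<^esub> exp_r"

lemma twist_closed [simp]: "c \<in> carrier B \<Longrightarrow> x \<in> carrier A \<Longrightarrow> twist c x \<in> carrier A"
  by (simp add: twist_def)

lemma twist_mult [simp]:
  "c \<in> carrier B \<Longrightarrow> x \<in> carrier A \<Longrightarrow> y \<in> carrier A \<Longrightarrow> twist c (x \<otimes>\<^bsub>A\<^esub> y) = twist c x \<otimes>\<^bsub>A\<^esub> twist c y"
  by (simp add: twist_def A.nat_pow_distrib A.m_ac)

lemma twist_inv [simp]: "c \<in> carrier B \<Longrightarrow> x \<in> carrier A \<Longrightarrow> twist c (inv\<^bsub>A\<^esub> x) = inv\<^bsub>A\<^esub> twist c x"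
  by (rule group_hom.hom_inv)
     (auto simp: group_hom_def group_hom_axioms_def A.is_group hom_def)

lemma twist_Ap: "c \<in> carrier B \<Longrightarrow> x \<in> Ap \<Longrightarrow> twist c x = \<phi> c x"
  by (simp add: twist_def pow_parts_Ap Ap_carrier)

lemma twist_Ar: "c \<in> carrier B \<Longrightarrow> x \<in> Ar \<Longrightarrow> twist c x = x"
  by (simp add: twist_def pow_parts_Ar Ar_carrier)

lemma twist_decomposed:
  "c \<in> carrier B \<Longrightarrow> y \<in> Ap \<Longrightarrow> z \<in> Ar \<Longrightarrow> twist c (y \<otimes>\<^bsub>A\<^esub> z) = \<phi> c y \<otimes>\<^bsub>A\<^esub> z"
  by (simp add: twist_Ap twist_Ar Ap_carrier Ar_carrier)

lemma act_twist:
  assumes "b \<in> carrier B" "c \<in> carrier B" "x \<in> carrier A"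
  shows "\<phi> b (twist c x) = twist c (\<phi> b x)"
  using assms by (simp add: twist_def act_pow act_commute[of b c])

lemma twist_twist:
  assumes "c \<in> carrier B" "d \<in> carrier B" "x \<in> carrier A"
  shows "twist c (twist d x) = twist (c \<otimes>\<^bsub>B\<^esub> d) x"
  using assms decompose[OF assms(3)]
  by (metis B.m_closed twist_decomposed act_Ap act_act Ap_carrier)

lemma twist_one [simp]: "x \<in> carrier A \<Longrightarrow> twist \<one>\<^bsub>B\<^esub> x = x"
  using decompose by (metis B.one_closed twist_decomposed act_by_one Ap_carrier)

definition twist_auto where "twist_auto c = (\<lambda>g\<in>carrier G. (twist c (fst g), snd g))"

lemma twist_auto_apply [simp]: "x \<in> carrier A \<Longrightarrow> h \<in> carrier B \<Longrightarrow> twist_auto c (x, h) = (twist c x, h)"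
  by (simp add: twist_auto_def)

lemma twist_auto_auto:
  assumes c: "c \<in> carrier B"
  shows "twist_auto c \<in> auto G"
proof -
  have "bij_betw (twist_auto c) (carrier G) (carrier G)"
    by (rule bij_betw_byWitness[where f' = "twist_auto (inv\<^bsub>B\<^esub> c)"]) (use c in \<open>auto simp: twist_twist\<close>)
  moreover have "twist_auto c \<in> hom G G"
    by (rule homI) (use c in \<open>auto simp: act_twist\<close>)
  moreover have "twist_auto c \<in> extensional (carrier G)"
    by (simp add: twist_auto_def)
  ultimately show ?thesis
    by (simp add: auto_def Bij_def)
qed

lemma multiplicity_order_G: "multiplicity p (order G) = k" "multiplicity r (order G) = l"
proof -
  have "\<not> p dvd order B" "\<not> r dvd order B"
    using coprime_orders primes exponents by (auto simp: order_A prime_imp_coprime coprime_absorb_left dest: not_prime_unit)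
  moreover have "\<not> p dvd r ^ l" "\<not> r dvd p ^ k"
    using primes by (metis prime_dvd_power_nat primes_dvd_imp_eq)+
  ultimately have "\<not> p dvd r ^ l * order B" "\<not> r dvd p ^ k * order B"
    using primes by (simp_all add: prime_dvd_mult_iff)
  moreover have "order G = p ^ k * (r ^ l * order B)" "order G = r ^ l * (p ^ k * order B)"
    by (simp_all add: order_G order_A)
  ultimately show "multiplicity p (order G) = k" "multiplicity r (order G) = l"
    using primes by (auto intro!: multiplicity_decomposeI prime_gt_0_nat)
qed

lemma prime_dvd_order_G: "p dvd order G" "r dvd order G"
  using exponents by (simp_all add: order_G order_A)

lemma sylow_Ap: "sylow_subgroup p (Ap \<times> {\<one>\<^bsub>B\<^esub>}) G"
  and sylow_Ar: "sylow_subgroup r (Ar \<times> {\<one>\<^bsub>B\<^esub>}) G"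
proof -
  have "subgroup Ap A" "subgroup Ar A"
    by (auto intro!: A.subgroupI simp: Ap_def Ar_def A.nat_pow_distrib A.nat_pow_inv)
  then have "subgroup (Ap \<times> {\<one>\<^bsub>B\<^esub>}) G" "subgroup (Ar \<times> {\<one>\<^bsub>B\<^esub>}) G"
    using group_hom.subgroup_img_is_subgroup[OF group_hom_incl]
    by (force simp: image_def elim!: back_subst[of "\<lambda>P. subgroup P G"])+
  then show "sylow_subgroup p (Ap \<times> {\<one>\<^bsub>B\<^esub>}) G" "sylow_subgroup r (Ar \<times> {\<one>\<^bsub>B\<^esub>}) G"
    by (simp_all add: sylow_subgroup_def multiplicity_order_G card_cartesian_product card_Ap card_Ar)
qed

text \<open>
  A Sylow subgroup for a prime other than \<open>p\<close> and \<open>r\<close> consists of elements \<open>(a\<^sup>-\<^sup>1 h(a), h)\<close>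
  for one fixed \<open>a\<close> in \<open>A\<close>: it is the conjugate by \<open>a\<close> of a subgroup of \<open>B\<close>, which the twist
  fixes pointwise. The twist therefore conjugates it by the quotient of \<open>twist c a\<close> and \<open>a\<close>.
\<close>
lemma twist_auto_coleman:
  assumes c: "c \<in> carrier B"
  shows "twist_auto c \<in> coleman_auto G"
proof (rule coleman_autoI[OF twist_auto_auto[OF c]])
  fix q P assume q: "prime q" "q dvd order G" and "sylow_subgroup q P G"
  then have P: "subgroup P G" "card P = q ^ multiplicity q (order G)"
    by (auto simp: sylow_subgroup_def)
  consider "q = p" | "q = r" | "q \<noteq> p" "q \<noteq> r" by blast
  then show "\<exists>g\<in>carrier G. \<forall>x\<in>P. twist_auto c x = conj_by G g x"
  proof cases
    case 1
    then have card: "card P = p ^ k" using P(2) multiplicity_order_G by simp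
    show ?thesis
    proof (intro bexI ballI)
      fix g assume g: "g \<in> P"
      have "card P dvd order A" by (simp add: card order_A)
      then obtain x where "x \<in> carrier A" "x [^]\<^bsub>A\<^esub> card P = \<one>\<^bsub>A\<^esub>" and gx: "g = (x, \<one>\<^bsub>B\<^esub>)"
        using subgroup_of_order_dividing_A[OF P(1) _ g] by blast
      then have "x \<in> Ap" by (simp add: Ap_def card)
      with gx show "twist_auto c g = conj_by G (\<one>\<^bsub>A\<^esub>, inv\<^bsub>B\<^esub> c) g"
        using c Ap_carrier by (simp add: twist_Ap conj_by_G)
    qed (use c in simp)
  next
    case 2
    then have card: "card P = r ^ l" using P(2) multiplicity_order_G by simp
    show ?thesis
    proof (intro bexI ballI)
      fix g assume g: "g \<in> P"
      have "card P dvd order A" by (simp add: card order_A)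
      then obtain x where "x \<in> carrier A" "x [^]\<^bsub>A\<^esub> card P = \<one>\<^bsub>A\<^esub>" and gx: "g = (x, \<one>\<^bsub>B\<^esub>)"
        using subgroup_of_order_dividing_A[OF P(1) _ g] by blast
      then have "x \<in> Ar" by (simp add: Ar_def card)
      with gx show "twist_auto c g = conj_by G \<one>\<^bsub>G\<^esub> g"
        using c Ar_carrier by (simp add: twist_Ar conj_by_G)
    qed simp
  next
    case 3
    then have "coprime (card P) (order A)"
      using primes q(1) by (simp add: P(2) order_A primes_coprime)
    then obtain a where a: "a \<in> carrier A"
      "\<And>g. g \<in> P \<Longrightarrow> snd g \<in> carrier B \<and> g = (inv\<^bsub>A\<^esub> a \<otimes>\<^bsub>A\<^esub> \<phi> (snd g) a, snd g)"
      using coprime_subgroup_conjugate[OF P(1)] by blast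
    show ?thesis
    proof (intro bexI ballI)
      fix g assume "g \<in> P"
      then obtain h where h: "h \<in> carrier B" "g = (inv\<^bsub>A\<^esub> a \<otimes>\<^bsub>A\<^esub> \<phi> h a, h)"
        using a(2) by blast
      have "inv\<^bsub>A\<^esub> (inv\<^bsub>A\<^esub> a \<otimes>\<^bsub>A\<^esub> twist c a) \<otimes>\<^bsub>A\<^esub> (inv\<^bsub>A\<^esub> a \<otimes>\<^bsub>A\<^esub> \<phi> h a) \<otimes>\<^bsub>A\<^esub> \<phi> h (inv\<^bsub>A\<^esub> a \<otimes>\<^bsub>A\<^esub> twist c a)
          = (a \<otimes>\<^bsub>A\<^esub> inv\<^bsub>A\<^esub> a) \<otimes>\<^bsub>A\<^esub> (\<phi> h a \<otimes>\<^bsub>A\<^esub> inv\<^bsub>A\<^esub> \<phi> h a) \<otimes>\<^bsub>A\<^esub> (inv\<^bsub>A\<^esub> twist c a \<otimes>\<^bsub>A\<^esub> \<phi> h (twist c a))"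
        using a(1) c h(1) act_closed twist_closed
        by (simp only: A.inv_mult A.m_ac A.inv_closed A.m_closed A.inv_inv act_mult act_inv)
      also have "\<dots> = inv\<^bsub>A\<^esub> twist c a \<otimes>\<^bsub>A\<^esub> \<phi> h (twist c a)"
        using a(1) c h(1) by simp
      finally show "twist_auto c g = conj_by G (inv\<^bsub>A\<^esub> a \<otimes>\<^bsub>A\<^esub> twist c a, \<one>\<^bsub>B\<^esub>) g"
        using a(1) c h by (simp add: conj_by_G act_twist)
    qed (use a(1) c in simp)
  qed
qed

text \<open>
  Conjugations act on \<open>A\<close> through \<open>B\<close> only, so \<open>s\<close> acts on \<open>A\<^sub>p\<close> as some \<open>b\<close> and on \<open>A\<^sub>r\<close> as some \<open>d\<close>.
  Splitting off \<open>d\<close>, which an inner automorphism can undo, leaves the twist by \<open>c = d\<^sup>-\<^sup>1 b\<close>.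
\<close>
lemma coleman_on_A:
  assumes s: "s \<in> coleman_auto G"
  obtains c d where "c \<in> carrier B" "d \<in> carrier B"
    "\<And>x. x \<in> carrier A \<Longrightarrow> s (x, \<one>\<^bsub>B\<^esub>) = (\<phi> d (twist c x), \<one>\<^bsub>B\<^esub>)"
proof -
  have hom: "s \<in> hom G G" using s by (simp add: coleman_auto_def auto_def)
  have conj: "\<exists>b\<in>carrier B. \<forall>x\<in>S. s (x, \<one>\<^bsub>B\<^esub>) = (\<phi> b x, \<one>\<^bsub>B\<^esub>)"
    if q: "prime q" "q dvd order G" "sylow_subgroup q (S \<times> {\<one>\<^bsub>B\<^esub>}) G" and S: "S \<subseteq> carrier A" for q S
  proof -
    obtain g where g: "g \<in> carrier G" "\<And>x. x \<in> S \<times> {\<one>\<^bsub>B\<^esub>} \<Longrightarrow> s x = conj_by G g x"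
      using coleman_autoD[OF s q] by blast
    then obtain a b where ab: "g = (a, b)" "a \<in> carrier A" "b \<in> carrier B" by auto
    have "s (x, \<one>\<^bsub>B\<^esub>) = (\<phi> (inv\<^bsub>B\<^esub> b) x, \<one>\<^bsub>B\<^esub>)" if x: "x \<in> S" for x
    proof -
      have "inv\<^bsub>A\<^esub> a \<otimes>\<^bsub>A\<^esub> x \<otimes>\<^bsub>A\<^esub> a = x"
        using ab x S by (simp add: A.m_comm[of _ a] A.m_assoc[symmetric] subsetD)
      then show ?thesis
        using g(2)[of "(x, \<one>\<^bsub>B\<^esub>)"] ab x S by (simp add: conj_by_G subsetD)
    qed
    then show ?thesis using ab by blast
  qed
  obtain b where b: "b \<in> carrier B" "\<And>x. x \<in> Ap \<Longrightarrow> s (x, \<one>\<^bsub>B\<^esub>) = (\<phi> b x, \<one>\<^bsub>B\<^esub>)"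
    using conj[OF primes(1) prime_dvd_order_G(1) sylow_Ap] Ap_carrier by blast
  obtain d where d: "d \<in> carrier B" "\<And>x. x \<in> Ar \<Longrightarrow> s (x, \<one>\<^bsub>B\<^esub>) = (\<phi> d x, \<one>\<^bsub>B\<^esub>)"
    using conj[OF primes(2) prime_dvd_order_G(2) sylow_Ar] Ar_carrier by blast
  show thesis
  proof (rule that[of "inv\<^bsub>B\<^esub> d \<otimes>\<^bsub>B\<^esub> b" d])
    fix x assume "x \<in> carrier A"
    then obtain y z where yz: "y \<in> Ap" "z \<in> Ar" "x = y \<otimes>\<^bsub>A\<^esub> z" by (rule decompose)
    have "s (x, \<one>\<^bsub>B\<^esub>) = s ((y, \<one>\<^bsub>B\<^esub>) \<otimes>\<^bsub>G\<^esub> (z, \<one>\<^bsub>B\<^esub>))"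
      using yz by (simp add: Ap_carrier Ar_carrier)
    also have "\<dots> = s (y, \<one>\<^bsub>B\<^esub>) \<otimes>\<^bsub>G\<^esub> s (z, \<one>\<^bsub>B\<^esub>)"
      using yz by (intro hom_mult[OF hom]) (simp_all add: Ap_carrier Ar_carrier)
    also have "\<dots> = (\<phi> b y \<otimes>\<^bsub>A\<^esub> \<phi> d z, \<one>\<^bsub>B\<^esub>)"
      using yz b d by (simp add: Ap_carrier Ar_carrier)
    also have "d \<otimes>\<^bsub>B\<^esub> (inv\<^bsub>B\<^esub> d \<otimes>\<^bsub>B\<^esub> b) = b"
      using b(1) d(1) by (simp add: B.m_assoc[symmetric])
    then have "\<phi> b y \<otimes>\<^bsub>A\<^esub> \<phi> d z = \<phi> d (twist (inv\<^bsub>B\<^esub> d \<otimes>\<^bsub>B\<^esub> b) x)"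
      using yz b(1) d(1) by (simp add: twist_decomposed act_act Ap_carrier Ar_carrier del: twist_mult)
    finally show "s (x, \<one>\<^bsub>B\<^esub>) = (\<phi> d (twist (inv\<^bsub>B\<^esub> d \<otimes>\<^bsub>B\<^esub> b) x), \<one>\<^bsub>B\<^esub>)" .
  qed (use b(1) d(1) in auto)
qed

lemma faithful:
  assumes "b \<in> carrier B" "c \<in> carrier B" "\<And>x. x \<in> carrier A \<Longrightarrow> \<phi> b x = \<phi> c x"
  shows "b = c"
proof -
  have "inv\<^bsub>B\<^esub> c \<otimes>\<^bsub>B\<^esub> b = \<one>\<^bsub>B\<^esub>"
    using assms by (intro faithful_p) (auto simp: act_act[symmetric])
  then show ?thesis
    using assms(1,2) by (metis B.inv_closed B.inv_equality B.inv_inv)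
qed

lemma coleman_normal_form:
  assumes s: "s \<in> coleman_auto G"
  obtains c g where "c \<in> carrier B" "g \<in> carrier G" "s = compose (carrier G) (conj_by G g) (twist_auto c)"
proof -
  have sa: "s \<in> hom G G" "s \<in> extensional (carrier G)"
    using s by (auto simp: coleman_auto_def auto_def Bij_def)
  obtain c d where c: "c \<in> carrier B" and d: "d \<in> carrier B"
    and sA: "\<And>x. x \<in> carrier A \<Longrightarrow> s (x, \<one>\<^bsub>B\<^esub>) = (\<phi> d (twist c x), \<one>\<^bsub>B\<^esub>)"
    using coleman_on_A[OF s] by blast
  define \<alpha> \<beta> where "\<alpha> h = fst (s (\<one>\<^bsub>A\<^esub>, h))" and "\<beta> h = snd (s (\<one>\<^bsub>A\<^esub>, h))" for h
  have sB: "s (\<one>\<^bsub>A\<^esub>, h) = (\<alpha> h, \<beta> h)" for h by (simp add: \<alpha>_def \<beta>_def)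
  have \<alpha>: "\<alpha> h \<in> carrier A" and \<beta>: "\<beta> h \<in> carrier B" if "h \<in> carrier B" for h
    using hom_in_carrier[OF sa(1), of "(\<one>\<^bsub>A\<^esub>, h)"] that by (simp_all add: sB)
  (* Applying s to the relation h x = h(x) h shows that \<beta> h and h act alike on A. *)
  have \<beta>_id: "\<beta> h = h" if h: "h \<in> carrier B" for h
  proof (rule faithful[OF \<beta>[OF h] h])
    fix y assume y: "y \<in> carrier A"
    define x where "x = twist (inv\<^bsub>B\<^esub> c) (\<phi> (inv\<^bsub>B\<^esub> d) y)"
    have x: "x \<in> carrier A" "\<phi> d (twist c x) = y"
      using c d y by (simp_all add: x_def twist_twist)
    have "(\<one>\<^bsub>A\<^esub>, h) \<otimes>\<^bsub>G\<^esub> (x, \<one>\<^bsub>B\<^esub>) = (\<phi> h x, \<one>\<^bsub>B\<^esub>) \<otimes>\<^bsub>G\<^esub> (\<one>\<^bsub>A\<^esub>, h)"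
      using h x by simp
    then have "s (\<one>\<^bsub>A\<^esub>, h) \<otimes>\<^bsub>G\<^esub> s (x, \<one>\<^bsub>B\<^esub>) = s (\<phi> h x, \<one>\<^bsub>B\<^esub>) \<otimes>\<^bsub>G\<^esub> s (\<one>\<^bsub>A\<^esub>, h)"
      using h x by (simp add: hom_mult[OF sa(1), symmetric] del: mult_G)
    moreover have "\<phi> d (twist c (\<phi> h x)) = \<phi> h y"
      using c d h x by (metis act_twist act_commute twist_closed)
    ultimately have "\<alpha> h \<otimes>\<^bsub>A\<^esub> \<phi> (\<beta> h) y = \<phi> h y \<otimes>\<^bsub>A\<^esub> \<alpha> h"
      using h x c d by (simp add: sA sB \<alpha> \<beta>)
    then show "\<phi> (\<beta> h) y = \<phi> h y"
      using \<alpha>[OF h] \<beta>[OF h] h y by (simp add: A.m_comm[of _ "\<alpha> h"])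
  qed
  (* Hence \<alpha> is a cocycle; conjugation by a then accounts for the action of s on B. *)
  obtain a where a: "a \<in> carrier A" "\<And>h. h \<in> carrier B \<Longrightarrow> \<alpha> h = inv\<^bsub>A\<^esub> a \<otimes>\<^bsub>A\<^esub> \<phi> h a"
  proof (rule cocycle_is_coboundary[OF B.subgroup_self, of \<alpha>])
    fix h k assume hk: "h \<in> carrier B" "k \<in> carrier B"
    have "s ((\<one>\<^bsub>A\<^esub>, h) \<otimes>\<^bsub>G\<^esub> (\<one>\<^bsub>A\<^esub>, k)) = s (\<one>\<^bsub>A\<^esub>, h) \<otimes>\<^bsub>G\<^esub> s (\<one>\<^bsub>A\<^esub>, k)"
      using hk by (intro hom_mult[OF sa(1)]) simp_all
    then show "\<alpha> (h \<otimes>\<^bsub>B\<^esub> k) = \<alpha> h \<otimes>\<^bsub>A\<^esub> \<phi> h (\<alpha> k)"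
      using hk by (simp add: sB \<beta>_id)
  qed (use \<alpha> in blast)+
  (* Conjugation by a pair with second component inv d applies d to all of A, and hence to the
     first component of the pair too; therefore inv d is applied to a beforehand. *)
  define g where "g = (\<phi> (inv\<^bsub>B\<^esub> d) a, inv\<^bsub>B\<^esub> d)"
  have g: "g \<in> carrier G" using a d by (simp add: g_def)
  show thesis
  proof (rule that[OF c g])
    show "s = compose (carrier G) (conj_by G g) (twist_auto c)"
    proof (rule extensionalityI[of _ "carrier G"])
      fix y assume "y \<in> carrier G"
      then obtain x h where y: "y = (x, h)" "x \<in> carrier A" "h \<in> carrier B" by auto
      have "s y = s ((x, \<one>\<^bsub>B\<^esub>) \<otimes>\<^bsub>G\<^esub> (\<one>\<^bsub>A\<^esub>, h))"
        using y by simp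
      also have "\<dots> = s (x, \<one>\<^bsub>B\<^esub>) \<otimes>\<^bsub>G\<^esub> s (\<one>\<^bsub>A\<^esub>, h)"
        using y by (intro hom_mult[OF sa(1)]) simp_all
      also have "\<dots> = (\<phi> d (twist c x) \<otimes>\<^bsub>A\<^esub> (inv\<^bsub>A\<^esub> a \<otimes>\<^bsub>A\<^esub> \<phi> h a), h)"
        using y a c d by (simp add: sA sB \<beta>_id)
      also have "\<dots> = conj_by G g (twist_auto c y)"
        using y a c d by (simp add: g_def conj_by_G act_commute[of h "inv\<^bsub>B\<^esub> d"] A.m_ac)
      finally show "s y = compose (carrier G) (conj_by G g) (twist_auto c) y"
        using y by (simp add: compose_def)
    qed (use sa in auto)
  qed
qed

lemma twist_auto_inner_imp_one:
  assumes c: "c \<in> carrier B" and inner: "twist_auto c \<in> Inn G"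
  shows "c = \<one>\<^bsub>B\<^esub>"
proof -
  obtain a b where ab: "a \<in> carrier A" "b \<in> carrier B" "twist_auto c = conj_by G (a, b)"
    using inner by (auto simp: Inn_def)
  have *: "twist c x = \<phi> (inv\<^bsub>B\<^esub> b) x" if x: "x \<in> carrier A" for x
  proof -
    have "inv\<^bsub>A\<^esub> a \<otimes>\<^bsub>A\<^esub> x \<otimes>\<^bsub>A\<^esub> a = x"
      using ab x by (simp add: A.m_comm[of _ a] A.m_assoc[symmetric])
    then show ?thesis
      using fun_cong[OF ab(3), of "(x, \<one>\<^bsub>B\<^esub>)"] ab(1,2) x by (simp add: conj_by_G)
  qed
  have "inv\<^bsub>B\<^esub> b = \<one>\<^bsub>B\<^esub>"
    using ab(2) c * by (intro faithful_r) (auto simp: twist_Ar Ar_def simp flip: *)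
  then show ?thesis
    using c * by (intro faithful_p) (auto simp: twist_Ap Ap_def simp flip: twist_Ap)
qed

lemma twist_auto_hom: "twist_auto \<in> hom B (Aut_col G)"
proof (rule homI)
  fix c d assume cd: "c \<in> carrier B" "d \<in> carrier B"
  show "twist_auto c \<in> carrier (Aut_col G)"
    using cd by (simp add: Aut_col_def twist_auto_coleman)
  have "twist_auto (c \<otimes>\<^bsub>B\<^esub> d) = compose (carrier G) (twist_auto c) (twist_auto d)"
    using cd by (intro extensionalityI[of _ "carrier G"]) (auto simp: twist_auto_def compose_def twist_twist)
  then show "twist_auto (c \<otimes>\<^bsub>B\<^esub> d) = twist_auto c \<otimes>\<^bsub>Aut_col G\<^esub> twist_auto d"
    using cd by (simp add: Aut_col_def mult_AutoGroup twist_auto_auto)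
qed

theorem Out_col_iso: "Out_col G \<cong> B"
proof -
  interpret C: group "Aut_col G" by (rule G.group_Aut_col)
  interpret N: normal "Inn G" "Aut_col G" by (rule G.normal_Inn)
  interpret O: group "Out_col G" by (rule G.group_Out_col)
  define \<Theta> where "\<Theta> = (\<lambda>c. Inn G #>\<^bsub>Aut_col G\<^esub> twist_auto c)"
  have "\<Theta> \<in> hom B (Out_col G)"
    using hom_compose[OF twist_auto_hom N.r_coset_hom_Mod] by (simp add: \<Theta>_def Out_col_def comp_def)
  then interpret \<Theta>: group_hom B "Out_col G" \<Theta>
    by (simp add: group_hom_def group_hom_axioms_def B.is_group O.is_group)
  have twist_autoC: "twist_auto c \<in> carrier (Aut_col G)" if "c \<in> carrier B" for c
    using twist_auto_hom that by (auto simp: hom_def)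
  have "inj_on \<Theta> (carrier B)"
  proof (rule \<Theta>.inj_on_one_iff[THEN iffD2], intro allI impI)
    fix c assume c: "c \<in> carrier B" and "\<Theta> c = \<one>\<^bsub>Out_col G\<^esub>"
    then have "Inn G #>\<^bsub>Aut_col G\<^esub> twist_auto c = Inn G"
      by (simp add: \<Theta>_def Out_col_def FactGroup_def)
    then have "twist_auto c \<in> Inn G"
      using C.coset_join1[OF _ twist_autoC[OF c] N.subgroup_axioms] by blast
    then show "c = \<one>\<^bsub>B\<^esub>" by (rule twist_auto_inner_imp_one[OF c])
  qed
  moreover have "carrier (Out_col G) \<subseteq> \<Theta> ` carrier B"
  proof
    fix X assume "X \<in> carrier (Out_col G)"
    then obtain s where s: "s \<in> coleman_auto G" "X = Inn G #>\<^bsub>Aut_col G\<^esub> s"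
      by (auto simp: Out_col_def FactGroup_def RCOSETS_def Aut_col_def)
    obtain c g where cg: "c \<in> carrier B" "g \<in> carrier G"
      "s = compose (carrier G) (conj_by G g) (twist_auto c)"
      using coleman_normal_form[OF s(1)] by blast
    have "s = conj_by G g \<otimes>\<^bsub>Aut_col G\<^esub> twist_auto c"
      using cg by (simp add: Aut_col_def mult_AutoGroup twist_auto_auto G.conj_by_in_auto)
    moreover have "conj_by G g \<in> Inn G"
      using cg by (simp add: Inn_def)
    ultimately have "s \<in> Inn G #>\<^bsub>Aut_col G\<^esub> twist_auto c"
      by (auto simp: r_coset_def)
    then have "X = \<Theta> c"
      using C.repr_independence[OF _ twist_autoC[OF cg(1)] N.subgroup_axioms] s(2) by (simp add: \<Theta>_def)
    then show "X \<in> \<Theta> ` carrier B" using cg(1) by blast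
  qed
  ultimately have "\<Theta> \<in> iso B (Out_col G)"
    using \<Theta>.homh by (auto simp: iso_def bij_betw_def hom_def)
  then show ?thesis
    using group.iso_sym[OF B.is_group] is_isoI by blast
qed

end

section \<open>Transport of an action along isomorphisms\<close>

lemma nat_copy:
  fixes G :: "('a, 'm) monoid_scheme"
  assumes "comm_group G" "finite (carrier G)"
  obtains A :: "nat monoid" and f where "comm_group A" "finite (carrier A)" "f \<in> iso G A"
proof -
  interpret comm_group G by fact
  obtain f :: "'a \<Rightarrow> nat" where inj: "inj_on f (carrier G)"
    using finite_imp_inj_to_nat_seg[OF assms(2)] by blast
  have iso: "f \<in> iso G (image_group f G)"
    using inj by (auto simp: iso_def hom_def bij_betw_def image_group_def)
  have "comm_group (image_group f G)"
    using iso_imp_img_comm_group[OF iso] by (simp add: image_group_def)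
  moreover have "finite (carrier (image_group f G))"
    using assms(2) by (simp add: image_group_carrier)
  ultimately show thesis using iso that by blast
qed

definition transport_act ::
  "('a, 'm) monoid_scheme \<Rightarrow> ('c, 'o) monoid_scheme \<Rightarrow> ('a \<Rightarrow> 'c) \<Rightarrow> ('b \<Rightarrow> 'd) \<Rightarrow>
    ('d \<Rightarrow> 'a \<Rightarrow> 'a) \<Rightarrow> 'b \<Rightarrow> 'c \<Rightarrow> 'c" where
  "transport_act R A f g \<theta> b = (\<lambda>x\<in>carrier A. f (\<theta> (g b) (inv_into (carrier R) f x)))"

lemma transport_act_image:
  assumes "f \<in> iso R A" "u \<in> carrier R"
  shows "transport_act R A f g \<theta> b (f u) = f (\<theta> (g b) u)"
  using assms by (auto simp: transport_act_def iso_def hom_def bij_betw_def)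

lemma transport_act_hom:
  assumes "group R" "group A" and \<theta>: "\<theta> \<in> hom H (AutoGroup R)"
    and f: "f \<in> iso R A" and g: "g \<in> hom B H"
  shows "transport_act R A f g \<theta> \<in> hom B (AutoGroup A)"
proof -
  let ?\<phi> = "transport_act R A f g \<theta>" and ?f' = "inv_into (carrier R) f"
  have f': "?f' \<in> iso A R"
    using group.iso_set_sym[OF assms(1) f] .
  have f'C: "?f' x \<in> carrier R" if "x \<in> carrier A" for x
    using f' that by (auto simp: iso_def hom_def)
  have f'f: "?f' (f x) = x" if "x \<in> carrier R" for x
    using f that by (auto simp: iso_def bij_betw_def)
  have \<theta>R: "\<theta> (g b) \<in> auto R" if "b \<in> carrier B" for b
    using \<theta> g that by (auto simp: hom_def AutoGroup_def)
  have \<theta>C: "\<theta> (g b) x \<in> carrier R" if "b \<in> carrier B" "x \<in> carrier R" for b x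
    using \<theta>R[OF that(1)] that(2) by (auto simp: auto_def hom_def)
  have auto: "?\<phi> b \<in> auto A" if b: "b \<in> carrier B" for b
  proof -
    have "\<theta> (g b) \<in> iso R R"
      using \<theta>R[OF b] by (auto simp: auto_def Bij_def iso_def)
    then have "f \<circ> (\<theta> (g b) \<circ> ?f') \<in> iso A A"
      using iso_set_trans[OF iso_set_trans[OF f'] f] by blast
    then have "?\<phi> b \<in> iso A A"
      using monoid.m_closed[OF group.is_monoid[OF assms(2)]]
      by (auto simp: transport_act_def iso_def hom_def cong: bij_betw_cong)
    then show ?thesis
      by (auto simp: auto_def Bij_def iso_def transport_act_def)
  qed
  have "?\<phi> (b \<otimes>\<^bsub>B\<^esub> c) = ?\<phi> b \<otimes>\<^bsub>AutoGroup A\<^esub> ?\<phi> c" if bc: "b \<in> carrier B" "c \<in> carrier B" for b c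
  proof -
    have "\<theta> (g (b \<otimes>\<^bsub>B\<^esub> c)) = compose (carrier R) (\<theta> (g b)) (\<theta> (g c))"
      using hom_mult[OF g bc] hom_mult[OF \<theta>, of "g b" "g c"] bc g \<theta>R
      by (simp add: mult_AutoGroup hom_in_carrier[OF g])
    then have "?\<phi> (b \<otimes>\<^bsub>B\<^esub> c) = compose (carrier A) (?\<phi> b) (?\<phi> c)"
      using f bc by (intro extensionalityI[of _ "carrier A"])
        (auto simp: transport_act_def compose_def f'C f'f \<theta>C iso_def hom_def Pi_iff)
    then show ?thesis
      using bc auto by (simp add: mult_AutoGroup)
  qed
  then show ?thesis
    using auto by (auto simp: hom_def AutoGroup_def)
qed

section \<open>The regular module of a finite group\<close>

abbreviation regular_module :: "('h, 'm) monoid_scheme \<Rightarrow> nat \<Rightarrow> ('h \<Rightarrow> int) monoid" where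
  "regular_module H m \<equiv> product_group (carrier H) (\<lambda>_. integer_mod_group m)"

text \<open>
  Translation on the right by \<open>b\<close>, rather than by its inverse, makes this a left action.
\<close>
definition translate :: "('h, 'm) monoid_scheme \<Rightarrow> nat \<Rightarrow> 'h \<Rightarrow> ('h \<Rightarrow> int) \<Rightarrow> 'h \<Rightarrow> int" where
  "translate H m b = (\<lambda>x\<in>carrier (regular_module H m). \<lambda>h\<in>carrier H. x (h \<otimes>\<^bsub>H\<^esub> b))"

lemma comm_group_regular_module: "comm_group (regular_module H m)"
  by (rule group.group_comm_groupI) (auto simp: add.commute)

lemma order_regular_module:
  assumes "finite (carrier H)" "0 < m"
  shows "finite (carrier (regular_module H m))" "order (regular_module H m) = m ^ order H"
  using assms by (auto simp: order_def card_PiE carrier_integer_mod_group intro: finite_PiE)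

lemma (in group) translate_closed:
  assumes "b \<in> carrier G" "x \<in> carrier (regular_module G m)"
  shows "translate G m b x \<in> carrier (regular_module G m)"
  using assms by (auto simp: translate_def PiE_iff)

lemma (in group) translate_hom: "translate G m \<in> hom G (AutoGroup (regular_module G m))"
proof -
  let ?R = "regular_module G m" and ?t = "translate G m"
  interpret R: comm_group ?R by (rule comm_group_regular_module)
  note closed = translate_closed[where m = m]
  have comp: "?t b (?t c x) = ?t (b \<otimes> c) x"
    if "b \<in> carrier G" "c \<in> carrier G" "x \<in> carrier ?R" for b c x
    using that closed[OF that(2,3)] by (auto simp: translate_def m_assoc)
  have one: "?t \<one> x = x" if "x \<in> carrier ?R" for x
    using that by (auto simp: translate_def PiE_iff extensional_def)
  have auto: "?t b \<in> auto ?R" if b: "b \<in> carrier G" for b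
  proof -
    have "bij_betw (?t b) (carrier ?R) (carrier ?R)"
      by (rule bij_betw_byWitness[where f' = "?t (inv b)"])
         (use b closed in \<open>auto simp: comp one simp del: carrier_product_group\<close>)
    moreover have "?t b \<in> hom ?R ?R"
    proof (rule homI)
      fix x y assume xy: "x \<in> carrier ?R" "y \<in> carrier ?R"
      then have "x \<otimes>\<^bsub>?R\<^esub> y \<in> carrier ?R"
        by (rule R.m_closed)
      then show "?t b (x \<otimes>\<^bsub>?R\<^esub> y) = ?t b x \<otimes>\<^bsub>?R\<^esub> ?t b y"
        using xy b by (auto simp: translate_def simp del: carrier_product_group)
    qed (use closed[OF b] in auto)
    ultimately show ?thesis
      by (simp add: auto_def Bij_def translate_def del: carrier_product_group)
  qed
  show ?thesis
  proof (rule homI)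
    fix b c assume bc: "b \<in> carrier G" "c \<in> carrier G"
    show "?t b \<in> carrier (AutoGroup ?R)"
      using auto[OF bc(1)] by (simp add: AutoGroup_def)
    have "?t (b \<otimes> c) = compose (carrier ?R) (?t b) (?t c)"
    proof (rule extensionalityI[of _ "carrier ?R"])
      show "?t (b \<otimes> c) \<in> extensional (carrier ?R)"
        by (simp only: translate_def restrict_extensional)
      show "?t (b \<otimes> c) x = compose (carrier ?R) (?t b) (?t c) x" if "x \<in> carrier ?R" for x
        using comp[OF bc that] that by (simp only: compose_eq)
    qed (rule compose_extensional)
    then show "?t (b \<otimes> c) = ?t b \<otimes>\<^bsub>AutoGroup ?R\<^esub> ?t c"
      using bc auto by (simp add: mult_AutoGroup)
  qed
qed

text \<open>
  The function supported at \<open>\<one>\<close> with value \<open>t\<close> has order \<open>d\<close>, and no nontrivial translation fixes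
  its support.
\<close>
lemma (in group) translate_faithful_on_torsion:
  assumes m: "m = d * t" "1 < d" "0 < t" and b: "b \<in> carrier G"
    and fixed: "\<And>x. x \<in> carrier (regular_module G m) \<Longrightarrow>
      x [^]\<^bsub>regular_module G m\<^esub> d = \<one>\<^bsub>regular_module G m\<^esub> \<Longrightarrow> translate G m b x = x"
  shows "b = \<one>"
proof -
  let ?R = "regular_module G m"
  define u where "u = (\<lambda>h\<in>carrier G. if h = \<one> then int t else 0)"
  have m0: "0 < m" and tm: "t < m" using m by simp_all
  have u: "u \<in> carrier ?R"
    using tm m0 by (auto simp: u_def carrier_integer_mod_group)
  have pow: "u [^]\<^bsub>?R\<^esub> n = (\<lambda>h\<in>carrier G. (int n * u h) mod int m)" for n :: nat
    by (induction n) (auto simp: nat_pow_def algebra_simps mod_add_right_eq)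
  have "(int d * u h) mod int m = 0" if "h \<in> carrier G" for h
    using that m(1) by (simp add: u_def)
  then have "u [^]\<^bsub>?R\<^esub> d = \<one>\<^bsub>?R\<^esub>"
    unfolding pow by auto
  then have "translate G m b u = u"
    using fixed u by blast
  then have "u b = u \<one>"
    using u b by (auto simp: translate_def dest: fun_cong[of _ _ \<one>])
  then show "b = \<one>"
    using b m(3) by (auto simp: u_def split: if_splits)
qed

section \<open>Finite abelian groups as groups of outer Coleman automorphisms\<close>

theorem theorem3p3:
  fixes H :: "('h, 'm) monoid_scheme"
  assumes "comm_group H" and "finite (carrier H)"
  shows "\<exists>(A :: nat monoid) (B :: nat monoid) \<phi>.
           comm_group A \<and> finite (carrier A) \<and>
           comm_group B \<and> finite (carrier B) \<and>
           \<phi> \<in> hom B (AutoGroup A) \<and>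
           Out_col (semidirect A B \<phi>) \<cong> H"
proof -
  interpret H: comm_group H by fact
  (* The bounds make p and r distinct and prime to the order of H. *)
  obtain p where p: "prime p" "order H < p" using bigger_prime by blast
  obtain r where r: "prime r" "p < r" using bigger_prime by blast
  define m where "m = p * r"
  let ?R = "regular_module H m" and ?n = "order H"
  have n: "0 < ?n" using H.order_gt_0_iff_finite assms(2) by blast
  have bounds: "1 < p" "0 < p" "1 < r" "0 < r"
    using p(1) r(1) by (simp_all add: prime_gt_1_nat prime_gt_0_nat del: One_nat_def)
  then have m0: "0 < m" by (simp add: m_def)
  interpret R: comm_group ?R by (rule comm_group_regular_module)
  obtain A :: "nat monoid" and f where A: "comm_group A" "finite (carrier A)" and f: "f \<in> iso ?R A"
    using nat_copy[OF R.comm_group_axioms order_regular_module(1)[OF assms(2) m0]] by blast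
  obtain B :: "nat monoid" and g' where B: "comm_group B" "finite (carrier B)" and g': "g' \<in> iso H B"
    using nat_copy[OF assms] by blast
  interpret A: comm_group A by fact
  interpret B: comm_group B by fact
  define g where "g = inv_into (carrier H) g'"
  have g: "g \<in> iso B H" using H.iso_set_sym[OF g'] by (simp add: g_def)
  define \<phi> where "\<phi> = transport_act ?R A f g (translate H m)"
  have \<phi>: "\<phi> \<in> hom B (AutoGroup A)"
    unfolding \<phi>_def using g
    by (intro transport_act_hom[OF R.is_group A.is_group H.translate_hom f]) (simp add: iso_def)
  have order_B: "order B = ?n"
    using iso_same_card[OF is_isoI[OF g]] by (simp add: order_def)
  have order_A: "order A = p ^ ?n * r ^ ?n"
    using iso_same_card[OF is_isoI[OF f]] order_regular_module(2)[OF assms(2) m0]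
    by (simp add: order_def m_def power_mult_distrib)
  have "\<not> p dvd order B" "\<not> r dvd order B"
    using n p(2) r(2) by (auto simp: order_B dest!: dvd_imp_le)
  then have coprime: "coprime (order A) (order B)"
    using p(1) r(1) by (simp add: order_A prime_imp_coprime)
  have faithful: "b = \<one>\<^bsub>B\<^esub>"
    if b: "b \<in> carrier B" and d: "m = d * t" "1 < d" "0 < t"
      and fixed: "\<And>x. x \<in> carrier A \<Longrightarrow> x [^]\<^bsub>A\<^esub> (d ^ ?n) = \<one>\<^bsub>A\<^esub> \<Longrightarrow> \<phi> b x = x" for b d t
  proof -
    have gb: "g b \<in> carrier H" using g b by (auto simp: iso_def hom_def)
    interpret f: group_hom ?R A f
      using f by (simp add: group_hom_def group_hom_axioms_def R.is_group A.is_group iso_def)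
    have "g b = \<one>\<^bsub>H\<^esub>"
    proof (rule H.translate_faithful_on_torsion[OF d gb])
      fix u assume u: "u \<in> carrier ?R" "u [^]\<^bsub>?R\<^esub> d = \<one>\<^bsub>?R\<^esub>"
      have "d dvd d ^ ?n" using n by simp
      then have "u [^]\<^bsub>?R\<^esub> (d ^ ?n) = \<one>\<^bsub>?R\<^esub>"
        using u R.pow_cong_exponent[OF u, of "d ^ ?n" 0] by (simp add: cong_0_iff)
      then have "f u [^]\<^bsub>A\<^esub> (d ^ ?n) = \<one>\<^bsub>A\<^esub>"
        using f.hom_nat_pow[OF u(1), of "d ^ ?n"] f.hom_one by argo
      then have "f (translate H m (g b) u) = f u"
        using fixed[OF f.hom_closed[OF u(1)]] transport_act_image[OF f u(1), of g "translate H m" b]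
        by (simp add: \<phi>_def)
      moreover have "translate H m (g b) u \<in> carrier ?R"
        by (rule H.translate_closed[OF gb u(1)])
      ultimately show "translate H m (g b) u = u"
        using f u(1) by (auto simp: iso_def bij_betw_def dest: inj_onD)
    qed
    moreover have "g \<one>\<^bsub>B\<^esub> = \<one>\<^bsub>H\<^esub>"
      using g hom_one[OF _ B.is_group H.is_group] by (simp add: iso_def)
    moreover have "inj_on g (carrier B)"
      using g by (simp add: iso_def bij_betw_def)
    ultimately show "b = \<one>\<^bsub>B\<^esub>"
      using inj_onD[OF _ _ b B.one_closed, of g] by argo
  qed
  interpret two_prime_action A B \<phi> p r ?n ?n
  proof unfold_locales
    fix b assume b: "b \<in> carrier B"
    show "b = \<one>\<^bsub>B\<^esub>" if "\<And>x. x \<in> carrier A \<Longrightarrow> x [^]\<^bsub>A\<^esub> (p ^ ?n) = \<one>\<^bsub>A\<^esub> \<Longrightarrow> \<phi> b x = x"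
      using faithful[of b p r] b that bounds by (simp add: m_def)
    show "b = \<one>\<^bsub>B\<^esub>" if "\<And>x. x \<in> carrier A \<Longrightarrow> x [^]\<^bsub>A\<^esub> (r ^ ?n) = \<one>\<^bsub>A\<^esub> \<Longrightarrow> \<phi> b x = x"
      using faithful[of b r p] b that bounds by (simp add: m_def mult.commute)
  qed (use A B \<phi> p r n order_A coprime in auto)
  have "Out_col (semidirect A B \<phi>) \<cong> H"
    using Out_col_iso is_isoI[OF g] by (rule iso_trans)
  then show ?thesis using A B \<phi> by blast
qed

end
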